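(* Let $\alpha:I\to\mathbb{R}^3$ be a nonplanar arclength parametrized curve with curvature $\kappa_\alpha>0$ and torsion $\tau_\alpha$, and let $a,b,c$ be real constants with $a^2+b^2+c^2=1$. Then $\alpha$ is a helix associated to the unit $F$-constant vector field $W=aT_\alpha+bN_\alpha+cB_\alpha$ orthogonal to the axis (that is, there is a nonzero constant vector $V\in\mathbb{R}^3$ with $\langle W(s),V\rangle=0$ for all $s\in I$) if and only if $$-b\,\kappa_\alpha^2\left(\frac{\tau_\alpha}{\kappa_\alpha}\right)'=c\,\kappa_\alpha\big((1-c^2)\kappa_\alpha^2+(1-3a^2)\tau_\alpha^2\big)+a\,\tau_\alpha\big((1-a^2)\tau_\alpha^2+(1-3c^2)\kappa_\alpha^2\big)$$ on $I$.
   Context: $I$ is an open interval and all curves and functions are smooth ($C^\infty$). For an arclength parametrized curve $\alpha:I\to\mathbb{R}^3$ with $\kappa_\alpha>0$, the Frenet frame $\{T_\alpha,N_\alpha,B_\alpha\}$ satisfies $T_\alpha'=\kappa_\alpha N_\alpha$, $N_\alpha'=-\kappa_\alpha T_\alpha+\tau_\alpha B_\alpha$, $B_\alpha'=-\tau_\alpha N_\alpha$. "Nonplanar" means that $\alpha$ is not contained in a plane (the torsion is not identically zero). A vector field $W$ along $\alpha$ is called $F$-constant (with respect to the Frenet frame) if $W'=D_\alpha\times W$, where $D_\alpha=\tau_\alpha T_\alpha+\kappa_\alpha B_\alpha$ is the Darboux vector; equivalently, $W=aT_\alpha+bN_\alpha+cB_\alpha$ with real constants $a,b,c$. A curve $\alpha$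 is a helix if there is an $F$-constant vector field $W$ along $\alpha$ forming a constant angle with a fixed direction $V$ (a nonzero constant vector), called an axis of the helix. *)

theory Defs
  imports "HOL-Analysis.Analysis"
begin

text \<open>Curves and vector fields are total functions on the reals of which only the restriction to an
  open set \<open>I\<close> is meaningful; derivatives taken \<open>at\<close> points of \<open>I\<close> depend on that restriction only.\<close>

definition smooth_on_open :: "real set \<Rightarrow> (real \<Rightarrow> 'a::real_normed_vector) \<Rightarrow> bool" where
  "smooth_on_open I f \<longleftrightarrow>
     (\<forall>n. \<forall>s\<in>I. ((\<lambda>g t. vector_derivative g (at t)) ^^ n) f differentiable (at s))"

definition arclength_parametrized :: "real set \<Rightarrow> (real \<Rightarrow> real^3) \<Rightarrow> bool" where
  "arclength_parametrized I \<alpha> \<longleftrightarrow> (\<forall>s\<in>I. norm (vector_derivative \<alpha> (at s)) = 1)"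

definition planar_on :: "real set \<Rightarrow> (real \<Rightarrow> real^3) \<Rightarrow> bool" where
  "planar_on I \<alpha> \<longleftrightarrow> (\<exists>n d. n \<noteq> 0 \<and> \<alpha> ` I \<subseteq> {x. n \<bullet> x = d})"

text \<open>Frenet apparatus of a curve parametrized by arc length with positive curvature. The sign of the
  torsion is fixed by \<open>B' = - \<tau> N\<close>.\<close>

definition frenet_T :: "(real \<Rightarrow> real^3) \<Rightarrow> real \<Rightarrow> real^3" where
  "frenet_T \<alpha> s = vector_derivative \<alpha> (at s)"

definition curvature :: "(real \<Rightarrow> real^3) \<Rightarrow> real \<Rightarrow> real" where
  "curvature \<alpha> s = norm (vector_derivative (frenet_T \<alpha>) (at s))"

definition frenet_N :: "(real \<Rightarrow> real^3) \<Rightarrow> real \<Rightarrow> real^3" where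
  "frenet_N \<alpha> s = vector_derivative (frenet_T \<alpha>) (at s) /\<^sub>R curvature \<alpha> s"

definition frenet_B :: "(real \<Rightarrow> real^3) \<Rightarrow> real \<Rightarrow> real^3" where
  "frenet_B \<alpha> s = cross3 (frenet_T \<alpha> s) (frenet_N \<alpha> s)"

definition torsion :: "(real \<Rightarrow> real^3) \<Rightarrow> real \<Rightarrow> real" where
  "torsion \<alpha> s = - (vector_derivative (frenet_B \<alpha>) (at s) \<bullet> frenet_N \<alpha> s)"

definition darboux :: "(real \<Rightarrow> real^3) \<Rightarrow> real \<Rightarrow> real^3" where
  "darboux \<alpha> s = torsion \<alpha> s *\<^sub>R frenet_T \<alpha> s + curvature \<alpha> s *\<^sub>R frenet_B \<alpha> s"

definition F_constant :: "real set \<Rightarrow> (real \<Rightarrow> real^3) \<Rightarrow> (real \<Rightarrow> real^3) \<Rightarrow> bool" where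
  "F_constant I \<alpha> W \<longleftrightarrow>
     (\<forall>s\<in>I. (W has_vector_derivative cross3 (darboux \<alpha> s) (W s)) (at s))"

text \<open>\<open>\<alpha>\<close> is a helix on \<open>I\<close> associated to the field \<open>W\<close>, with axis \<open>V\<close>. Nonvanishing of \<open>W\<close> is
  required for the angle to be defined.\<close>

definition helix_with_axis ::
    "real set \<Rightarrow> (real \<Rightarrow> real^3) \<Rightarrow> (real \<Rightarrow> real^3) \<Rightarrow> real^3 \<Rightarrow> bool" where
  "helix_with_axis I \<alpha> W V \<longleftrightarrow>
     F_constant I \<alpha> W \<and> V \<noteq> 0 \<and>
     (\<exists>\<theta>\<in>{0..pi}. \<forall>s\<in>I. W s \<noteq> 0 \<and> W s \<bullet> V = norm (W s) * norm V * cos \<theta>)"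

end

theory Submission
  imports Defs
begin

text \<open>
  Write \<open>W1\<close>, \<open>W2\<close> for the first two derivatives of \<open>W\<close>. If \<open>W\<close> stays orthogonal to a fixed
  \<open>V \<noteq> 0\<close>, so do \<open>W1\<close> and \<open>W2\<close>, hence the triple product \<open>(W \<times> W1) \<bullet> W2\<close> vanishes. The
  Frenet equations turn this triple product into
  \<open>b \<kappa>\<^sup>2 (\<tau> / \<kappa>)'\<close> plus the right-hand side of the asserted equation
  (\<open>triple_product_eq_orthogonality_defect\<close>), so the equation says exactly that
  \<open>W\<close>, \<open>W1\<close>, \<open>W2\<close> are everywhere linearly dependent.

  The converse is the fact that a spherical curve without geodesic curvature runs on a great circle.
  When \<open>b \<noteq> 0\<close> the tangential component \<open>- b \<kappa>\<close> of \<open>W1\<close> never vanishes, so \<open>W \<times> W1 \<noteq> 0\<close>;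
  dependence makes the derivative of this vector a multiple of the vector itself, whence its direction
  is constant and serves as the axis (\<open>common_normal_of_triple_product_eq_0\<close>).

  When \<open>b = 0\<close> the field \<open>W\<close> may be stationary and that argument breaks down. But then the equation
  factors as \<open>(a \<kappa> - c \<tau>)\<^sup>2 (c \<kappa> + a \<tau>) = 0\<close>, so the continuous function
  \<open>(a \<kappa> - c \<tau>) / \<kappa>\<close> takes at most two values and is constant on the interval. Accordingly either
  \<open>W\<close> itself is constant or \<open>- c T + a B\<close> is a constant vector orthogonal to it.
\<close>

section \<open>Derivatives of vector-valued functions on an interval\<close>

lemma has_vector_derivative_inner:
  fixes f g :: "real \<Rightarrow> 'a::real_inner"
  assumes "(f has_vector_derivative f') (at s)" "(g has_vector_derivative g') (at s)"
  shows "((\<lambda>t. f t \<bullet> g t) has_vector_derivative (f s \<bullet> g' + f' \<bullet> g s)) (at s)"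
  by (rule bounded_bilinear.has_vector_derivative[OF bounded_bilinear_inner assms])

lemma has_vector_derivative_cross3:
  assumes "(f has_vector_derivative f') (at s)" "(g has_vector_derivative g') (at s)"
  shows "((\<lambda>t. cross3 (f t) (g t)) has_vector_derivative
           (cross3 (f s) g' + cross3 f' (g s))) (at s)"
  by (rule bounded_bilinear.has_vector_derivative
        [OF bilinear_cross[unfolded bilinear_conv_bounded_bilinear] assms])

lemma vector_derivative_eq_0_of_constant:
  fixes f :: "real \<Rightarrow> 'a::real_normed_vector"
  assumes "open I" "s \<in> I" "\<And>t. t \<in> I \<Longrightarrow> f t = k" "(f has_vector_derivative f') (at s)"
  shows "f' = 0"
proof -
  have "(f has_vector_derivative 0) (at s)"
    by (rule has_vector_derivative_transform_within_open[OF has_vector_derivative_const[of k]])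
       (use assms in auto)
  with assms(4) show ?thesis
    by (rule vector_derivative_unique_at)
qed

lemma constant_of_vector_derivative_eq_0:
  fixes f :: "real \<Rightarrow> 'a::banach"
  assumes "is_interval I" "\<And>s. s \<in> I \<Longrightarrow> (f has_vector_derivative 0) (at s)" "s \<in> I" "t \<in> I"
  shows "f s = f t"
proof -
  have "convex I"
    using assms(1) by (rule is_interval_convex)
  then obtain k where "\<And>x. x \<in> I \<Longrightarrow> f x = k"
    by (rule has_vector_derivative_zero_constant[of I f])
       (use assms(2) in \<open>auto intro: has_vector_derivative_at_within\<close>)
  with assms(3,4) show ?thesis
    by simp
qed

text \<open>A vector whose derivative is parallel to it changes its length only: the logarithmic
  derivative \<open>\<mu>\<close> of the length cancels upon normalization.\<close>
lemma sgn_has_vector_derivative_0: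
  fixes n :: "real \<Rightarrow> 'a::real_inner"
  assumes "(n has_vector_derivative \<mu> *\<^sub>R n s) (at s)" "n s \<noteq> 0"
  shows "((\<lambda>t. sgn (n t)) has_vector_derivative 0) (at s)"
proof -
  have pos: "n s \<bullet> n s > 0"
    using assms(2) by simp
  have sq: "((\<lambda>t. n t \<bullet> n t) has_real_derivative 2 * \<mu> * (n s \<bullet> n s)) (at s)"
    using has_vector_derivative_inner[OF assms(1,1)]
    by (simp add: has_real_derivative_iff_has_vector_derivative algebra_simps)
  define r where "r = sqrt (n s \<bullet> n s)"
  have r: "r > 0" "n s \<bullet> n s = r * r"
    using pos by (simp_all add: r_def)
  have "((\<lambda>t. inverse (sqrt (n t \<bullet> n t))) has_real_derivative - (\<mu> * inverse r)) (at s)"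
    by (rule DERIV_cong[OF DERIV_inverse'[OF DERIV_chain2[OF DERIV_real_sqrt[OF pos] sq]]])
       (use r in \<open>auto simp: field_simps\<close>)
  from has_vector_derivative_scaleR[OF this assms(1)] show ?thesis
    by (simp add: sgn_div_norm norm_eq_sqrt_inner r_def mult.commute)
qed

section \<open>Fields orthogonal to a fixed vector\<close>

text \<open>If \<open>x\<close> and \<open>y\<close> are orthogonal to \<open>V\<close>, their cross product is parallel to \<open>V\<close>, and \<open>z\<close> is
  orthogonal to that.\<close>
lemma triple_product_eq_0_of_common_normal:
  assumes "V \<noteq> 0" "x \<bullet> V = 0" "y \<bullet> V = 0" "z \<bullet> V = 0"
  shows "cross3 x y \<bullet> z = 0"
proof -
  have "cross3 V (cross3 x y) = 0"
    using assms by (simp add: Lagrange inner_commute)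
  then have "cross3 V (cross3 V (cross3 x y)) = 0"
    by simp
  then have "(V \<bullet> V) *\<^sub>R cross3 x y = (V \<bullet> cross3 x y) *\<^sub>R V"
    by (simp add: Lagrange[of V V])
  then have "(V \<bullet> V) * (cross3 x y \<bullet> z) = (V \<bullet> cross3 x y) * (V \<bullet> z)"
    by (metis inner_scaleR_left)
  with assms show ?thesis
    by (simp add: inner_commute)
qed

text \<open>The normal \<open>n = W \<times> W1\<close> has derivative \<open>W \<times> W2\<close>. This is orthogonal to \<open>W\<close>
  trivially and to \<open>W1\<close> because the triple product vanishes, so it is a multiple of \<open>n\<close>. Hence \<open>sgn n\<close>
  is constant on the interval; independence of \<open>W\<close> and \<open>W1\<close> is what keeps it from jumping.\<close>
lemma common_normal_of_triple_product_eq_0: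
  fixes W W1 W2 :: "real \<Rightarrow> real^3"
  assumes I: "is_interval I" "I \<noteq> {}"
    and W: "\<And>s. s \<in> I \<Longrightarrow> (W has_vector_derivative W1 s) (at s)"
    and W1: "\<And>s. s \<in> I \<Longrightarrow> (W1 has_vector_derivative W2 s) (at s)"
    and indep: "\<And>s. s \<in> I \<Longrightarrow> cross3 (W s) (W1 s) \<noteq> 0"
    and triple: "\<And>s. s \<in> I \<Longrightarrow> cross3 (W s) (W1 s) \<bullet> W2 s = 0"
  shows "\<exists>V. V \<noteq> 0 \<and> (\<forall>s\<in>I. W s \<bullet> V = 0)"
proof -
  define n where "n = (\<lambda>s. cross3 (W s) (W1 s))"
  have sgn_n: "((\<lambda>t. sgn (n t)) has_vector_derivative 0) (at s)" if s: "s \<in> I" for s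
  proof -
    define n1 where "n1 = cross3 (W s) (W2 s)"
    have d: "(n has_vector_derivative n1) (at s)"
      using has_vector_derivative_cross3[OF W[OF s] W1[OF s]] by (simp add: n_def n1_def)
    have "n1 \<bullet> W s = 0"
      by (simp add: n1_def dot_cross_self inner_commute)
    moreover have "n1 \<bullet> W1 s = 0"
    proof -
      have "n1 \<bullet> W1 s = - (cross3 (W s) (W1 s) \<bullet> W2 s)"
        unfolding n1_def by (metis cross_skew cross_triple inner_minus_left)
      then show ?thesis
        by (simp add: triple[OF s])
    qed
    ultimately have "cross3 n1 (n s) = 0"
      by (simp add: n_def Lagrange)
    then have "cross3 (n s) (cross3 n1 (n s)) = 0"
      by simp
    then have eq: "(n s \<bullet> n s) *\<^sub>R n1 = (n s \<bullet> n1) *\<^sub>R n s"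
      by (simp add: Lagrange)
    have n0: "n s \<noteq> 0"
      using indep[OF s] by (simp add: n_def)
    have "n1 = ((n s \<bullet> n1) / (n s \<bullet> n s)) *\<^sub>R n s"
    proof -
      have "n1 = inverse (n s \<bullet> n s) *\<^sub>R ((n s \<bullet> n s) *\<^sub>R n1)"
        using n0 by simp
      also have "\<dots> = ((n s \<bullet> n1) / (n s \<bullet> n s)) *\<^sub>R n s"
        unfolding eq by (simp add: divide_inverse mult.commute)
      finally show ?thesis .
    qed
    with d n0 show ?thesis
      by (metis sgn_has_vector_derivative_0)
  qed
  obtain s0 where s0: "s0 \<in> I"
    using I(2) by blast
  have "W s \<bullet> sgn (n s0) = 0" if s: "s \<in> I" for s
  proof -
    have "sgn (n s0) = sgn (n s)"
      by (rule constant_of_vector_derivative_eq_0[OF I(1) sgn_n s0 s])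
    then show ?thesis
      by (simp add: sgn_div_norm n_def dot_cross_self)
  qed
  moreover have "sgn (n s0) \<noteq> 0"
    using indep[OF s0] by (simp add: n_def sgn_zero_iff)
  ultimately show ?thesis
    by blast
qed

section \<open>Moving frames satisfying the Frenet equations\<close>

text \<open>The behaviour of \<open>F\<close>-constant fields depends on the frame only, not on the curve that carries
  it. Curvature and torsion are differentiable so that these fields have second derivatives.\<close>
locale frenet_frame =
  fixes I :: "real set" and T N B :: "real \<Rightarrow> real^3" and \<kappa> \<tau> :: "real \<Rightarrow> real"
  assumes open_I: "open I"
    and interval_I: "is_interval I"
    and nonempty_I: "I \<noteq> {}"
    and curvature_pos: "s \<in> I \<Longrightarrow> \<kappa> s > 0"
    and TT: "s \<in> I \<Longrightarrow> T s \<bullet> T s = 1"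
    and NN: "s \<in> I \<Longrightarrow> N s \<bullet> N s = 1"
    and TN: "s \<in> I \<Longrightarrow> T s \<bullet> N s = 0"
    and B_eq: "B s = cross3 (T s) (N s)"
    and T_derivative: "s \<in> I \<Longrightarrow> (T has_vector_derivative \<kappa> s *\<^sub>R N s) (at s)"
    and N_derivative:
      "s \<in> I \<Longrightarrow> (N has_vector_derivative - \<kappa> s *\<^sub>R T s + \<tau> s *\<^sub>R B s) (at s)"
    and curvature_differentiable: "s \<in> I \<Longrightarrow> \<kappa> field_differentiable at s"
    and torsion_differentiable: "s \<in> I \<Longrightarrow> \<tau> field_differentiable at s"
begin

definition framed :: "real \<Rightarrow> real \<Rightarrow> real \<Rightarrow> real \<Rightarrow> real^3" where
  "framed x y z s = x *\<^sub>R T s + y *\<^sub>R N s + z *\<^sub>R B s"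

lemma NT: "s \<in> I \<Longrightarrow> N s \<bullet> T s = 0"
  using TN[of s] by (simp add: inner_commute)

lemma BT: "B s \<bullet> T s = 0" and BN: "B s \<bullet> N s = 0"
  by (simp_all add: B_eq dot_cross_self inner_commute[of "cross3 x y" for x y])

lemma BB: "s \<in> I \<Longrightarrow> B s \<bullet> B s = 1"
  by (simp add: B_eq dot_cross TT NN TN NT)

lemma cross_NB: "s \<in> I \<Longrightarrow> cross3 (N s) (B s) = T s"
  and cross_BT: "s \<in> I \<Longrightarrow> cross3 (B s) (T s) = N s"
  by (simp_all add: B_eq Lagrange cross_skew[of "cross3 (T s) (N s)"] TT NN TN NT)

lemma inner_framed:
  "s \<in> I \<Longrightarrow> framed x y z s \<bullet> framed x' y' z' s = x * x' + y * y' + z * z'"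
  by (simp add: framed_def inner_add_left inner_add_right TT NN BB TN NT BT BN
        inner_commute[of "T s" "B s"] inner_commute[of "N s" "B s"])

lemma framed_eq_0_iff: "s \<in> I \<Longrightarrow> framed x y z s = 0 \<longleftrightarrow> x = 0 \<and> y = 0 \<and> z = 0"
  using inner_framed[of s x y z x y z]
  by (auto simp: framed_def add_nonneg_eq_0_iff)

lemma cross_framed:
  assumes "s \<in> I"
  shows "cross3 (framed x y z s) (framed x' y' z' s) =
           framed (y * z' - z * y') (z * x' - x * z') (x * y' - y * x') s"
proof -
  have "cross3 (N s) (T s) = - B s" "cross3 (B s) (N s) = - T s" "cross3 (T s) (B s) = - N s"
    using assms by (metis B_eq cross_skew, metis cross_NB cross_skew, metis cross_BT cross_skew)
  with assms show ?thesis
    by (simp add: framed_def cross_add_left cross_add_right cross_mult_left cross_mult_right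
          B_eq[symmetric] cross_NB cross_BT algebra_simps)
qed

lemma B_derivative:
  assumes "s \<in> I"
  shows "(B has_vector_derivative - \<tau> s *\<^sub>R N s) (at s)"
proof -
  have "cross3 (T s) (- \<kappa> s *\<^sub>R T s + \<tau> s *\<^sub>R B s) + cross3 (\<kappa> s *\<^sub>R N s) (N s) = - \<tau> s *\<^sub>R N s"
    using cross_BT[OF assms] cross_skew[of "T s" "B s"]
    by (simp add: Cross3.right_diff_distrib cross_mult_left cross_mult_right)
  moreover have "B = (\<lambda>t. cross3 (T t) (N t))"
    by (rule ext) (rule B_eq)
  ultimately show ?thesis
    using has_vector_derivative_cross3[OF T_derivative[OF assms] N_derivative[OF assms]] by metis
qed

lemma framed_derivative:
  assumes "s \<in> I"
    and "(x has_real_derivative x') (at s)" "(y has_real_derivative y') (at s)"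
      "(z has_real_derivative z') (at s)"
  shows "((\<lambda>t. framed (x t) (y t) (z t) t) has_vector_derivative
           framed (x' - \<kappa> s * y s) (y' + \<kappa> s * x s - \<tau> s * z s) (z' + \<tau> s * y s) s) (at s)"
  unfolding framed_def
  by (rule derivative_eq_intros assms T_derivative[OF assms(1)] N_derivative[OF assms(1)]
        B_derivative[OF assms(1)] refl)+
     (simp add: algebra_simps)

text \<open>The next two lemmas give the same derivative twice: in coordinates, for the
  triple product, and as the cross product with the Darboux vector, which is what
  \<open>F\<close>-constancy asks for.\<close>
lemma framed_const_derivative:
  assumes "s \<in> I"
  shows "(framed a b c has_vector_derivative
           framed (- (b * \<kappa> s)) (a * \<kappa> s - c * \<tau> s) (b * \<tau> s) s) (at s)"
  using framed_derivative[OF assms, of "\<lambda>_. a" 0 "\<lambda>_. b" 0 "\<lambda>_. c" 0]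
  by (simp add: mult.commute)

lemma framed_const_derivative_eq_cross_darboux:
  assumes "s \<in> I"
  shows "(framed a b c has_vector_derivative
           cross3 (\<tau> s *\<^sub>R T s + \<kappa> s *\<^sub>R B s) (framed a b c s)) (at s)"
proof -
  have "\<tau> s *\<^sub>R T s + \<kappa> s *\<^sub>R B s = framed (\<tau> s) 0 (\<kappa> s) s"
    by (simp add: framed_def)
  then show ?thesis
    using framed_const_derivative[OF assms, of a b c] assms
    by (simp add: cross_framed mult.commute)
qed

definition second_derivative :: "real \<Rightarrow> real \<Rightarrow> real \<Rightarrow> real \<Rightarrow> real^3" where
  "second_derivative a b c s =
     framed (- (b * deriv \<kappa> s) - \<kappa> s * (a * \<kappa> s - c * \<tau> s))
       (a * deriv \<kappa> s - c * deriv \<tau> s - b * (\<kappa> s)\<^sup>2 - b * (\<tau> s)\<^sup>2)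
       (b * deriv \<tau> s + \<tau> s * (a * \<kappa> s - c * \<tau> s)) s"

lemma framed_const_second_derivative:
  assumes "s \<in> I"
  shows "((\<lambda>t. framed (- (b * \<kappa> t)) (a * \<kappa> t - c * \<tau> t) (b * \<tau> t) t)
           has_vector_derivative second_derivative a b c s) (at s)"
proof -
  note k = curvature_differentiable[OF assms, unfolded DERIV_deriv_iff_field_differentiable[symmetric]]
  note t = torsion_differentiable[OF assms, unfolded DERIV_deriv_iff_field_differentiable[symmetric]]
  have "((\<lambda>t. - (b * \<kappa> t)) has_real_derivative - (b * deriv \<kappa> s)) (at s)"
    "((\<lambda>t. a * \<kappa> t - c * \<tau> t) has_real_derivative a * deriv \<kappa> s - c * deriv \<tau> s) (at s)"
    "((\<lambda>t. b * \<tau> t) has_real_derivative b * deriv \<tau> s) (at s)"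
    by (rule derivative_eq_intros k t refl | simp)+
  from framed_derivative[OF assms this] show ?thesis
    by (rule has_vector_derivative_eq_rhs)
       (simp add: second_derivative_def power2_eq_square algebra_simps)
qed

text \<open>Right-hand side minus left-hand side of the equation that characterizes the helices
  orthogonal to their axis.\<close>
definition orthogonality_defect :: "real \<Rightarrow> real \<Rightarrow> real \<Rightarrow> real \<Rightarrow> real" where
  "orthogonality_defect a b c s = b * (\<kappa> s)\<^sup>2 * deriv (\<lambda>t. \<tau> t / \<kappa> t) s
     + c * \<kappa> s * ((1 - c\<^sup>2) * (\<kappa> s)\<^sup>2 + (1 - 3 * a\<^sup>2) * (\<tau> s)\<^sup>2)
     + a * \<tau> s * ((1 - a\<^sup>2) * (\<tau> s)\<^sup>2 + (1 - 3 * c\<^sup>2) * (\<kappa> s)\<^sup>2)"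

text \<open>In the triple product of \<open>W\<close>, \<open>W1\<close>, \<open>W2\<close> the derivatives of curvature and torsion enter
  only through \<open>\<tau>' \<kappa> - \<tau> \<kappa>'\<close>, the numerator of the derivative of \<open>\<tau> / \<kappa>\<close>. The rest is a cubic
  form in \<open>\<kappa>\<close>, \<open>\<tau>\<close> from which \<open>b\<close> is eliminated by \<open>a\<^sup>2 + b\<^sup>2 + c\<^sup>2 = 1\<close>.\<close>
lemma triple_product_eq_orthogonality_defect:
  assumes s: "s \<in> I" and unit: "a\<^sup>2 + b\<^sup>2 + c\<^sup>2 = 1"
  shows "cross3 (framed a b c s) (framed (- (b * \<kappa> s)) (a * \<kappa> s - c * \<tau> s) (b * \<tau> s) s)
           \<bullet> second_derivative a b c s = orthogonality_defect a b c s"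
proof -
  define k t k1 t1 where "k = \<kappa> s" and "t = \<tau> s" and "k1 = deriv \<kappa> s" and "t1 = deriv \<tau> s"
  have "k \<noteq> 0"
    using curvature_pos[OF s] by (simp add: k_def)
  have "((\<lambda>t. \<tau> t / \<kappa> t) has_real_derivative (t1 * k - t * k1) / (k * k)) (at s)"
    unfolding k_def t_def k1_def t1_def
    by (rule DERIV_divide)
       (use s curvature_pos[OF s] curvature_differentiable torsion_differentiable
         in \<open>auto simp: DERIV_deriv_iff_field_differentiable\<close>)
  then have ratio: "k\<^sup>2 * deriv (\<lambda>t. \<tau> t / \<kappa> t) s = t1 * k - t * k1"
    using \<open>k \<noteq> 0\<close> by (simp add: DERIV_imp_deriv power2_eq_square)
  have b2: "b\<^sup>2 = 1 - a\<^sup>2 - c\<^sup>2"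
    using unit by simp
  have "orthogonality_defect a b c s = b * (t1 * k - t * k1)
      + c * k * ((1 - c\<^sup>2) * k\<^sup>2 + (1 - 3 * a\<^sup>2) * t\<^sup>2)
      + a * t * ((1 - a\<^sup>2) * t\<^sup>2 + (1 - 3 * c\<^sup>2) * k\<^sup>2)"
    unfolding orthogonality_defect_def ratio[symmetric] by (simp add: k_def t_def mult.assoc)
  also have "\<dots> = (b * (b * t) - c * (a * k - c * t)) * (- (b * k1) - k * (a * k - c * t))
      + (c * - (b * k) - a * (b * t)) * (a * k1 - c * t1 - b * k\<^sup>2 - b * t\<^sup>2)
      + (a * (a * k - c * t) - b * - (b * k)) * (b * t1 + t * (a * k - c * t))"
    using b2 by algebra
  finally show ?thesis
    using s by (simp add: cross_framed inner_framed second_derivative_def k_def t_def k1_def t1_def)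
qed

lemma orthogonality_defect_eq_0_of_orthogonal:
  assumes unit: "a\<^sup>2 + b\<^sup>2 + c\<^sup>2 = 1"
    and V: "V \<noteq> 0" "\<And>s. s \<in> I \<Longrightarrow> framed a b c s \<bullet> V = 0" and s: "s \<in> I"
  shows "orthogonality_defect a b c s = 0"
proof -
  define W1 where "W1 = (\<lambda>t. framed (- (b * \<kappa> t)) (a * \<kappa> t - c * \<tau> t) (b * \<tau> t) t)"
  have orth: "f' \<bullet> V = 0"
    if "\<And>t. t \<in> I \<Longrightarrow> f t \<bullet> V = 0" "t \<in> I" "(f has_vector_derivative f') (at t)" for f f' t
    using vector_derivative_eq_0_of_constant[OF open_I that(2,1)
        has_vector_derivative_inner[OF that(3) has_vector_derivative_const[of V]]] by simp
  have V1: "W1 t \<bullet> V = 0" if "t \<in> I" for t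
    using orth[OF V(2) that framed_const_derivative[OF that]] by (simp add: W1_def)
  have "second_derivative a b c s \<bullet> V = 0"
    using orth[OF V1 s] framed_const_second_derivative[OF s, of b a c] by (simp add: W1_def)
  with triple_product_eq_0_of_common_normal[OF V(1) V(2)[OF s] V1[OF s]] show ?thesis
    using triple_product_eq_orthogonality_defect[OF s unit] by (simp add: W1_def)
qed

lemma orthogonal_of_orthogonality_defect_eq_0_normal:
  assumes unit: "a\<^sup>2 + b\<^sup>2 + c\<^sup>2 = 1" and "b \<noteq> 0"
    and eq: "\<And>s. s \<in> I \<Longrightarrow> orthogonality_defect a b c s = 0"
  shows "\<exists>V. V \<noteq> 0 \<and> (\<forall>s\<in>I. framed a b c s \<bullet> V = 0)"
proof (rule common_normal_of_triple_product_eq_0[OF interval_I nonempty_I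
      framed_const_derivative framed_const_second_derivative])
  fix s assume s: "s \<in> I"
  show "cross3 (framed a b c s) (framed (- (b * \<kappa> s)) (a * \<kappa> s - c * \<tau> s) (b * \<tau> s) s)
          \<bullet> second_derivative a b c s = 0"
    using triple_product_eq_orthogonality_defect[OF s unit] eq[OF s] by simp
  \<comment> \<open>\<open>W\<close> has unit length and is orthogonal to \<open>W1\<close>, so \<open>W \<times> (W \<times> W1) = - W1\<close>, whose
    tangential component does not vanish.\<close>
  define x y z where "x = - (b * \<kappa> s)" and "y = a * \<kappa> s - c * \<tau> s" and "z = b * \<tau> s"
  have "(framed a b c s \<bullet> framed a b c s) = 1" "framed a b c s \<bullet> framed x y z s = 0"
    using unit by (simp_all add: inner_framed[OF s] x_def y_def z_def power2_eq_square algebra_simps)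
  then have "cross3 (framed a b c s) (cross3 (framed a b c s) (framed x y z s)) = - framed x y z s"
    by (simp add: Lagrange)
  moreover have "framed x y z s \<noteq> 0"
    using \<open>b \<noteq> 0\<close> curvature_pos[OF s] by (simp add: framed_eq_0_iff[OF s] x_def)
  ultimately have "cross3 (framed a b c s) (framed x y z s) \<noteq> 0"
    by auto
  then show "cross3 (framed a b c s)
      (framed (- (b * \<kappa> s)) (a * \<kappa> s - c * \<tau> s) (b * \<tau> s) s) \<noteq> 0"
    by (simp add: x_def y_def z_def)
qed

text \<open>For \<open>b = 0\<close> the field lies in the rectifying plane and may have zero derivative, so the
  normal \<open>W \<times> W1\<close> gives no direction and the axis has to be found by hand.\<close>
lemma orthogonal_of_orthogonality_defect_eq_0_rectifying:
  assumes unit: "a\<^sup>2 + c\<^sup>2 = 1"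
    and eq: "\<And>s. s \<in> I \<Longrightarrow> orthogonality_defect a 0 c s = 0"
  shows "\<exists>V. V \<noteq> 0 \<and> (\<forall>s\<in>I. framed a 0 c s \<bullet> V = 0)"
proof -
  have factor: "a * \<kappa> s = c * \<tau> s \<or> c * \<kappa> s + a * \<tau> s = 0" if "s \<in> I" for s
  proof -
    have "(a * \<kappa> s - c * \<tau> s)\<^sup>2 * (c * \<kappa> s + a * \<tau> s) = orthogonality_defect a 0 c s"
      using unit unfolding orthogonality_defect_def by algebra
    with eq[OF that] show ?thesis
      by simp
  qed
  obtain s0 where s0: "s0 \<in> I"
    using nonempty_I by blast
  \<comment> \<open>The two factors cannot vanish together, and \<open>g\<close> separates the two cases by its value: where
    \<open>c \<kappa> + a \<tau> = 0\<close>, substituting for \<open>\<tau>\<close> gives \<open>g = (a\<^sup>2 + c\<^sup>2) / a\<close>.\<close>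
  define g where "g = (\<lambda>s. (a * \<kappa> s - c * \<tau> s) / \<kappa> s)"
  have g: "g s = 0 \<or> a \<noteq> 0 \<and> g s = 1 / a" if "s \<in> I" for s
  proof (cases "a * \<kappa> s = c * \<tau> s")
    case False
    with factor[OF that] have eq: "c * \<kappa> s + a * \<tau> s = 0"
      by blast
    then have "a \<noteq> 0"
      using unit curvature_pos[OF that] by auto
    moreover have "a * (a * \<kappa> s - c * \<tau> s) = \<kappa> s"
      using eq unit by algebra
    ultimately show ?thesis
      using curvature_pos[OF that] by (simp add: g_def field_simps)
  qed (simp add: g_def)
  have "continuous_on I g"
    unfolding g_def
    by (intro continuous_intros continuous_at_imp_continuous_on)
       (auto intro: field_differentiable_imp_continuous_at
          curvature_differentiable torsion_differentiable dest: curvature_pos)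
  moreover have "connected I"
    using interval_I by (simp add: is_interval_connected)
  moreover have "finite (g ` I)"
    by (rule finite_subset[of _ "{0, 1 / a}"]) (use g in auto)
  ultimately have "g constant_on I"
    using continuous_finite_range_constant by blast
  then obtain k where k: "\<And>s. s \<in> I \<Longrightarrow> g s = k"
    by (auto simp: constant_on_def)
  have "(\<forall>s\<in>I. a * \<kappa> s = c * \<tau> s) \<or> a \<noteq> 0 \<and> (\<forall>s\<in>I. c * \<kappa> s + a * \<tau> s = 0)"
  proof (cases "k = 0")
    case True
    have "a * \<kappa> s = c * \<tau> s" if "s \<in> I" for s
      using k[OF that] True curvature_pos[OF that] by (simp add: g_def)
    then show ?thesis
      by blast
  next
    case False
    have "c * \<kappa> s + a * \<tau> s = 0" if "s \<in> I" for s
      using factor[OF that] k[OF that] False by (auto simp: g_def)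
    moreover have "a \<noteq> 0"
      using g[OF s0] k[OF s0] False by simp
    ultimately show ?thesis
      by blast
  qed
  then show ?thesis
  proof
    assume h: "\<forall>s\<in>I. a * \<kappa> s = c * \<tau> s"
    \<comment> \<open>Here \<open>W\<close> is constant, so a vector orthogonal to its value at one point will do.\<close>
    have "framed a 0 c s \<bullet> N s0 = 0" if s: "s \<in> I" for s
    proof -
      have "(framed a 0 c has_vector_derivative 0) (at t)" if "t \<in> I" for t
        using framed_const_derivative[OF that, of a 0 c] h that by (simp add: framed_def)
      then have "framed a 0 c s = framed a 0 c s0"
        by (rule constant_of_vector_derivative_eq_0[OF interval_I _ s s0])
      moreover have "N s0 = framed 0 1 0 s0"
        by (simp add: framed_def)
      ultimately show ?thesis
        by (simp add: inner_framed[OF s0])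
    qed
    moreover have "N s0 \<noteq> 0"
      using NN[OF s0] by auto
    ultimately show ?thesis
      by blast
  next
    assume h: "a \<noteq> 0 \<and> (\<forall>s\<in>I. c * \<kappa> s + a * \<tau> s = 0)"
    \<comment> \<open>Here the constant field is the one at right angles to \<open>W\<close> in the rectifying plane.\<close>
    have "framed a 0 c s \<bullet> framed (- c) 0 a s0 = 0" if s: "s \<in> I" for s
    proof -
      have "(framed (- c) 0 a has_vector_derivative 0) (at t)" if "t \<in> I" for t
      proof -
        have "c * \<kappa> t + a * \<tau> t = 0"
          using h that by blast
        then have "- (c * \<kappa> t) - a * \<tau> t = 0"
          by linarith
        with framed_const_derivative[OF that, of "- c" 0 a] show ?thesis
          by (simp add: framed_def)
      qed
      then have "framed (- c) 0 a s0 = framed (- c) 0 a s"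
        by (rule constant_of_vector_derivative_eq_0[OF interval_I _ s0 s])
      then show ?thesis
        by (simp add: inner_framed[OF s] mult.commute)
    qed
    moreover have "framed (- c) 0 a s0 \<noteq> 0"
      using h by (simp add: framed_eq_0_iff[OF s0])
    ultimately show ?thesis
      by blast
  qed
qed

theorem orthogonal_iff_orthogonality_defect_eq_0:
  assumes "a\<^sup>2 + b\<^sup>2 + c\<^sup>2 = 1"
  shows "(\<exists>V. V \<noteq> 0 \<and> (\<forall>s\<in>I. framed a b c s \<bullet> V = 0)) \<longleftrightarrow>
         (\<forall>s\<in>I. orthogonality_defect a b c s = 0)"
proof (cases "b = 0")
  case True
  with assms show ?thesis
    using orthogonality_defect_eq_0_of_orthogonal[of a b c]
      orthogonal_of_orthogonality_defect_eq_0_rectifying[of a c]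
    by auto
next
  case False
  with assms show ?thesis
    using orthogonality_defect_eq_0_of_orthogonal[of a b c]
      orthogonal_of_orthogonality_defect_eq_0_normal[of a b c]
    by blast
qed

end

section \<open>The Frenet frame of a curve\<close>

lemma smooth_on_open_iterate:
  assumes "smooth_on_open I f" "s \<in> I"
  shows "(((\<lambda>g t. vector_derivative g (at t)) ^^ n) f has_vector_derivative
           ((\<lambda>g t. vector_derivative g (at t)) ^^ Suc n) f s) (at s)"
  using assms unfolding smooth_on_open_def by (simp add: vector_derivative_works)

locale arclength_curve =
  fixes I :: "real set" and \<alpha> :: "real \<Rightarrow> real^3"
  assumes open_I: "open I" and interval_I: "is_interval I" and nonempty_I: "I \<noteq> {}"
    and smooth: "smooth_on_open I \<alpha>"
    and arclength: "arclength_parametrized I \<alpha>"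
    and curvature_pos: "s \<in> I \<Longrightarrow> curvature \<alpha> s > 0"
begin

abbreviation "T \<equiv> frenet_T \<alpha>"
abbreviation "N \<equiv> frenet_N \<alpha>"
abbreviation "B \<equiv> frenet_B \<alpha>"
abbreviation "\<kappa> \<equiv> curvature \<alpha>"
abbreviation "\<tau> \<equiv> torsion \<alpha>"

definition T1 :: "real \<Rightarrow> real^3" where "T1 s = vector_derivative T (at s)"
definition T2 :: "real \<Rightarrow> real^3" where "T2 s = vector_derivative T1 (at s)"

lemma T_derivative: "s \<in> I \<Longrightarrow> (T has_vector_derivative T1 s) (at s)"
  and T1_derivative: "s \<in> I \<Longrightarrow> (T1 has_vector_derivative T2 s) (at s)"
  and T2_differentiable: "s \<in> I \<Longrightarrow> T2 differentiable (at s)"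
proof -
  have eq: "T = (\<lambda>t. vector_derivative \<alpha> (at t))" "T1 = (\<lambda>t. vector_derivative T (at t))"
    "T2 = (\<lambda>t. vector_derivative T1 (at t))"
    by (auto simp: frenet_T_def T1_def T2_def)
  note d = smooth_on_open_iterate[OF smooth]
  show "s \<in> I \<Longrightarrow> (T has_vector_derivative T1 s) (at s)"
    using d[of s 1] by (simp add: eq)
  show "s \<in> I \<Longrightarrow> (T1 has_vector_derivative T2 s) (at s)"
    using d[of s 2] by (simp add: eq numeral_2_eq_2)
  show "s \<in> I \<Longrightarrow> T2 differentiable (at s)"
    using d[of s 3] by (simp add: eq numeral_3_eq_3 differentiableI_vector)
qed

lemma T1_eq: "s \<in> I \<Longrightarrow> T1 s = \<kappa> s *\<^sub>R N s"
  using curvature_pos[of s] by (simp add: frenet_N_def T1_def)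

lemma T_unit: "s \<in> I \<Longrightarrow> T s \<bullet> T s = 1"
  using arclength by (simp add: arclength_parametrized_def frenet_T_def dot_square_norm)

lemma N_unit: "s \<in> I \<Longrightarrow> N s \<bullet> N s = 1"
  using curvature_pos[of s] by (simp add: frenet_N_def curvature_def dot_square_norm power2_eq_square)

lemma T_orth_N: "s \<in> I \<Longrightarrow> T s \<bullet> N s = 0"
proof -
  assume s: "s \<in> I"
  have "T s \<bullet> T1 s + T1 s \<bullet> T s = 0"
    by (rule vector_derivative_eq_0_of_constant[OF open_I s T_unit
          has_vector_derivative_inner[OF T_derivative[OF s] T_derivative[OF s]]])
  then show ?thesis
    using curvature_pos[OF s] by (simp add: T1_eq[OF s] inner_commute)
qed

lemma curvature_derivative:
  assumes "s \<in> I"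
  shows "(\<kappa> has_real_derivative (T1 s \<bullet> T2 s) / \<kappa> s) (at s)"
proof -
  have eq: "\<kappa> = (\<lambda>t. sqrt (T1 t \<bullet> T1 t))"
    by (auto simp: curvature_def T1_def norm_eq_sqrt_inner)
  have pos: "T1 s \<bullet> T1 s > 0"
    using curvature_pos[OF assms] by (simp add: eq)
  have "((\<lambda>t. T1 t \<bullet> T1 t) has_real_derivative 2 * (T1 s \<bullet> T2 s)) (at s)"
    using has_vector_derivative_inner[OF T1_derivative[OF assms] T1_derivative[OF assms]]
    by (simp add: has_real_derivative_iff_has_vector_derivative inner_commute)
  from DERIV_chain2[OF DERIV_real_sqrt[OF pos] this] show ?thesis
    unfolding eq by (rule DERIV_cong) (simp add: field_simps)
qed

text \<open>The multiple of \<open>N\<close>, which comes from differentiating the curvature, stays unspecified: it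
  is removed by any inner product with \<open>B\<close>.\<close>
lemma N_differentiable:
  assumes "s \<in> I"
  obtains m where "(N has_vector_derivative (T2 s /\<^sub>R \<kappa> s + m *\<^sub>R N s)) (at s)"
proof -
  have N: "N = (\<lambda>t. inverse (\<kappa> t) *\<^sub>R T1 t)"
    by (rule ext) (simp add: frenet_N_def T1_def)
  have "\<kappa> s \<noteq> 0"
    using curvature_pos[OF assms] by simp
  from has_vector_derivative_scaleR[OF DERIV_inverse'[OF curvature_derivative[OF assms] this]
      T1_derivative[OF assms]]
  show ?thesis
    unfolding N[symmetric] T1_eq[OF assms] scaleR_scaleR by (rule that)
qed

text \<open>The torsion is defined through the derivative of \<open>B = T \<times> N\<close>. As \<open>T1 \<times> N = 0\<close>, that
  derivative is \<open>T \<times> N'\<close>, and permuting the triple product moves the torsion to the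
  binormal component of \<open>N'\<close>.\<close>
lemma B_differentiable_and_N_derivative_inner_B:
  assumes s: "s \<in> I" and N': "(N has_vector_derivative N') (at s)"
  shows "B differentiable (at s)" and "N' \<bullet> B s = \<tau> s"
proof -
  have B: "B = (\<lambda>t. cross3 (T t) (N t))"
    by (rule ext) (simp add: frenet_B_def)
  have B': "(B has_vector_derivative cross3 (T s) N') (at s)"
    using has_vector_derivative_cross3[OF T_derivative[OF s] N']
    unfolding B by (simp add: T1_eq[OF s] cross_mult_left)
  then show "B differentiable (at s)"
    by (rule differentiableI_vector)
  have "N' \<bullet> B s = - (cross3 (T s) N' \<bullet> N s)"
    using cross_triple[of "T s" "N s" N'] cross_triple[of "N s" N' "T s"] cross_skew[of N' "T s"]
    by (simp add: frenet_B_def inner_commute[of N'])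
  then show "N' \<bullet> B s = \<tau> s"
    by (simp add: torsion_def vector_derivative_at[OF B'])
qed

text \<open>The components of \<open>N'\<close> along \<open>T\<close> and \<open>N\<close> come from differentiating \<open>T \<bullet> N = 0\<close> and
  \<open>N \<bullet> N = 1\<close>. The difference \<open>y\<close> of the two sides is then orthogonal to the whole frame: it is
  parallel to \<open>B\<close> because \<open>y \<times> (T \<times> N) = 0\<close>, and orthogonal to \<open>B\<close> as well.\<close>
lemma N_derivative:
  assumes s: "s \<in> I"
  shows "(N has_vector_derivative - \<kappa> s *\<^sub>R T s + \<tau> s *\<^sub>R B s) (at s)"
proof -
  obtain N' where N': "(N has_vector_derivative N') (at s)"
    using N_differentiable[OF s] by blast
  define y where "y = N' - (- \<kappa> s *\<^sub>R T s + \<tau> s *\<^sub>R B s)"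
  have BT: "B s \<bullet> T s = 0" and BN: "B s \<bullet> N s = 0"
    by (simp_all add: frenet_B_def dot_cross_self)
  have BB: "B s \<bullet> B s = 1"
    using T_unit[OF s] N_unit[OF s] T_orth_N[OF s] by (simp add: frenet_B_def dot_cross)
  have "T s \<bullet> N' + T1 s \<bullet> N s = 0"
    by (rule vector_derivative_eq_0_of_constant[OF open_I s T_orth_N
          has_vector_derivative_inner[OF T_derivative[OF s] N']])
  then have "N' \<bullet> T s = - \<kappa> s"
    using N_unit[OF s] by (simp add: T1_eq[OF s] inner_commute)
  then have yT: "y \<bullet> T s = 0"
    using T_unit[OF s] BT by (simp add: y_def inner_diff_left inner_add_left)
  have "N s \<bullet> N' + N' \<bullet> N s = 0"
    by (rule vector_derivative_eq_0_of_constant[OF open_I s N_unit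
          has_vector_derivative_inner[OF N' N']])
  then have "N' \<bullet> N s = 0"
    by (simp add: inner_commute)
  then have yN: "y \<bullet> N s = 0"
    using T_orth_N[OF s] BN by (simp add: y_def inner_diff_left inner_add_left)
  have yB: "y \<bullet> B s = 0"
    using B_differentiable_and_N_derivative_inner_B(2)[OF s N'] BT BB
    by (simp add: y_def inner_diff_left inner_add_left inner_commute[of "T s" "B s"])
  have "cross3 y (B s) = 0"
    using yT yN by (simp add: frenet_B_def Lagrange)
  then have "(norm y * norm (B s))\<^sup>2 = 0"
    using norm_cross_dot[of y "B s"] yB by simp
  then have "y = 0"
    using BB by auto
  with N' show ?thesis
    by (simp add: y_def)
qed

text \<open>The definition of the torsion contains a derivative, so its differentiability is read off from
  the explicit formula \<open>\<tau> = (B \<bullet> T2) / \<kappa>\<close>, valid on the open set \<open>I\<close>.\<close>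
lemma torsion_field_differentiable:
  assumes s: "s \<in> I"
  shows "\<tau> field_differentiable at s"
proof -
  from has_vector_derivative_inner
    [OF B_differentiable_and_N_derivative_inner_B(1)
        [OF s N_derivative[OF s], unfolded vector_derivative_works]
      T2_differentiable[OF s, unfolded vector_derivative_works]]
  have "(\<lambda>t. B t \<bullet> T2 t) field_differentiable at s"
    unfolding field_differentiable_def has_real_derivative_iff_has_vector_derivative by blast
  moreover have "\<kappa> field_differentiable at s"
    using curvature_derivative[OF s] by (auto simp: field_differentiable_def)
  ultimately have "(\<lambda>t. (B t \<bullet> T2 t) / \<kappa> t) field_differentiable at s"
    using curvature_pos[OF s] by (intro field_differentiable_divide) auto
  moreover have "(B t \<bullet> T2 t) / \<kappa> t = \<tau> t" if t: "t \<in> I" for t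
  proof -
    obtain m where m: "(N has_vector_derivative (T2 t /\<^sub>R \<kappa> t + m *\<^sub>R N t)) (at t)"
      using N_differentiable[OF t] .
    have "N t \<bullet> B t = 0"
      by (simp add: frenet_B_def dot_cross_self)
    with B_differentiable_and_N_derivative_inner_B(2)[OF t m] show ?thesis
      by (simp add: inner_add_left inner_commute[of "B t"] divide_inverse mult.commute)
  qed
  ultimately show ?thesis
    unfolding field_differentiable_def
    by (blast intro: has_field_derivative_transform_within_open[OF _ open_I s])
qed

sublocale frame: frenet_frame I T N B \<kappa> \<tau>
proof
  show "\<kappa> field_differentiable at s" if "s \<in> I" for s
    using curvature_derivative[OF that] by (auto simp: field_differentiable_def)
  show "(T has_vector_derivative \<kappa> s *\<^sub>R N s) (at s)" if "s \<in> I" for s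
    using T_derivative[OF that] by (simp add: T1_eq[OF that])
qed (rule open_I interval_I nonempty_I curvature_pos T_unit N_unit T_orth_N N_derivative
      torsion_field_differentiable frenet_B_def | assumption)+

lemma F_constant_framed: "F_constant I \<alpha> (frame.framed a b c)"
  unfolding F_constant_def darboux_def
  by (blast intro: frame.framed_const_derivative_eq_cross_darboux)

text \<open>Orthogonality is the constant angle \<open>\<pi> / 2\<close>, and the other clauses in the definition of a helix
  hold for every unit vector with constant coordinates in the frame.\<close>
lemma helix_with_orthogonal_axis_iff:
  assumes "a\<^sup>2 + b\<^sup>2 + c\<^sup>2 = 1"
  shows "helix_with_axis I \<alpha> (frame.framed a b c) V \<and> (\<forall>s\<in>I. frame.framed a b c s \<bullet> V = 0) \<longleftrightarrow>
           V \<noteq> 0 \<and> (\<forall>s\<in>I. frame.framed a b c s \<bullet> V = 0)"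
proof -
  have "frame.framed a b c s \<noteq> 0" if "s \<in> I" for s
    using assms by (auto simp: frame.framed_eq_0_iff[OF that])
  then show ?thesis
    by (auto simp: helix_with_axis_def F_constant_framed intro!: bexI[of _ "pi / 2"])
qed

end

section \<open>Helices orthogonal to their axis\<close>

theorem theorem5p1:
  fixes I :: "real set" and \<alpha> :: "real \<Rightarrow> real^3" and a b c :: real
  assumes "open I" and "is_interval I" and "I \<noteq> {}"
    and "smooth_on_open I \<alpha>"
    and "arclength_parametrized I \<alpha>"
    and "\<forall>s\<in>I. curvature \<alpha> s > 0"
    and "\<not> planar_on I \<alpha>"
    and "a\<^sup>2 + b\<^sup>2 + c\<^sup>2 = 1"
  defines "W \<equiv> \<lambda>s. a *\<^sub>R frenet_T \<alpha> s + b *\<^sub>R frenet_N \<alpha> s + c *\<^sub>R frenet_B \<alpha> s"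
  shows "(\<exists>V. helix_with_axis I \<alpha> W V \<and> (\<forall>s\<in>I. W s \<bullet> V = 0)) \<longleftrightarrow>
    (\<forall>s\<in>I. - b * (curvature \<alpha> s)\<^sup>2 * deriv (\<lambda>t. torsion \<alpha> t / curvature \<alpha> t) s
       = c * curvature \<alpha> s *
           ((1 - c\<^sup>2) * (curvature \<alpha> s)\<^sup>2 + (1 - 3 * a\<^sup>2) * (torsion \<alpha> s)\<^sup>2)
         + a * torsion \<alpha> s *
           ((1 - a\<^sup>2) * (torsion \<alpha> s)\<^sup>2 + (1 - 3 * c\<^sup>2) * (curvature \<alpha> s)\<^sup>2))"
proof -
  interpret arclength_curve I \<alpha>
    by unfold_locales (use assms(1-6) in auto)
  have W: "W = frame.framed a b c"
    by (rule ext) (simp add: W_def frame.framed_def)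
  have "(\<exists>V. helix_with_axis I \<alpha> W V \<and> (\<forall>s\<in>I. W s \<bullet> V = 0)) \<longleftrightarrow>
      (\<forall>s\<in>I. frame.orthogonality_defect a b c s = 0)"
    unfolding W helix_with_orthogonal_axis_iff[OF assms(8)]
    by (rule frame.orthogonal_iff_orthogonality_defect_eq_0[OF assms(8)])
  then show ?thesis
    unfolding frame.orthogonality_defect_def by (auto simp: algebra_simps)
qed

end
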